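(* Let $T$ be the template $123$, and let $k$ be a positive integer. Then there exists a positive integer $n$ such that whenever $[3]^n$ is $k$-coloured there exists a monochromatic copy of $T$ (i.e. a monochromatic block set with template $123$) with pattern $ABCCBA$.
   Context: Write $[m]=\{1,\dots,m\}$. A $k$-colouring of a set is a function from it to a set of $k$ colours. A block set with template $123$ in $[3]^n$ (also called a copy of $123$) is a set of words formed as follows: select pairwise disjoint nonempty sets $I_1,I_2,I_3\subseteq[n]$ (the blocks), all of the same size, and fixed values $a_i\in[3]$ for each $i\in[n]\setminus(I_1\cup I_2\cup I_3)$; the block set consists of all words $w\in[3]^n$ such that $w_i=a_i$ for all $i\notin I_1\cup I_2\cup I_3$ and there is a permutation $v=(v_1,v_2,v_3)$ of $(1,2,3)$ with $w_i=v_j$ whenever $i\in I_j$ (so it has 6 words). It is monochromatic if all its words receive the same colour. It has pattern $ABCCBA$ if the blocks have size 2 and their relative positions in the linear order on $[n]$ read $ABCCBA$: that is, there are $p_1<p_2<p_3<p_4<p_5<p_6$ in $[n]$ such that the three blocks are $A=\{p_1,p_6\}$, $B=\{p_2,p_5\}$ and $C=\{p_3,p_4\}$. *)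

theory Defs
  imports "HOL-Library.FuncSet" "HOL-Library.Disjoint_Sets" "HOL-Combinatorics.Permutations"
begin

definition words3 :: "nat \<Rightarrow> (nat \<Rightarrow> nat) set" where
  "words3 n = {1..n} \<rightarrow>\<^sub>E {1..3}"

definition blocks :: "nat \<Rightarrow> (nat \<Rightarrow> nat set) \<Rightarrow> bool" where
  "blocks n I \<longleftrightarrow>
     (\<forall>j\<in>{1..3}. I j \<subseteq> {1..n} \<and> I j \<noteq> {}) \<and>
     disjoint_family_on I {1..3} \<and>
     (\<forall>j\<in>{1..3}. \<forall>l\<in>{1..3}. card (I j) = card (I l))"

definition fixed_positions :: "nat \<Rightarrow> (nat \<Rightarrow> nat set) \<Rightarrow> nat set" where
  "fixed_positions n I = {1..n} - (\<Union>j\<in>{1..3}. I j)"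

definition block_set_123 ::
  "nat \<Rightarrow> (nat \<Rightarrow> nat set) \<Rightarrow> (nat \<Rightarrow> nat) \<Rightarrow> (nat \<Rightarrow> nat) set" where
  "block_set_123 n I a =
     {w \<in> words3 n. (\<forall>i\<in>fixed_positions n I. w i = a i) \<and>
        (\<exists>v. v permutes {1..3} \<and> (\<forall>j\<in>{1..3}. \<forall>i\<in>I j. w i = v j))}"

text \<open>The blocks are compared as an unordered triple, since the block set does not depend on
  their numbering.\<close>

definition pattern_ABCCBA :: "nat \<Rightarrow> (nat \<Rightarrow> nat set) \<Rightarrow> bool" where
  "pattern_ABCCBA n I \<longleftrightarrow>
     (\<exists>p1 p2 p3 p4 p5 p6. {p1, p2, p3, p4, p5, p6} \<subseteq> {1..n} \<and>
        p1 < p2 \<and> p2 < p3 \<and> p3 < p4 \<and> p4 < p5 \<and> p5 < p6 \<and>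
        I ` {1..3} = {{p1, p6}, {p2, p5}, {p3, p4}})"

definition monochromatic :: "('a \<Rightarrow> 'c) \<Rightarrow> 'a set \<Rightarrow> bool" where
  "monochromatic \<chi> S \<longleftrightarrow> (\<exists>c. \<forall>w\<in>S. \<chi> w = c)"

end

theory Submission
  imports "HOL-Library.Ramsey" Defs
begin

text \<open>
  Let \<open>L = 2 (k + 1)\<close> and, for \<open>i \<le> k\<close>, let \<open>s\<^sub>i\<close> be the word \<open>32\<dots>32 23 32\<dots>32\<close> of length \<open>L\<close>
  whose only \<open>23\<close> is in slot \<open>i\<close>. Writing these words on an \<open>L\<close>-set of positions, with the letter
  \<open>1\<close> everywhere else, gives a vector of \<open>k + 1\<close> colours for every \<open>L\<close>-set. By Ramsey's theorem
  there is a set of \<open>L + 2\<close> positions all of whose \<open>L\<close>-subsets have the same vector, and by the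
  pigeonhole principle two entries \<open>i < j\<close> of this vector agree. Since \<open>s\<^sub>i = u 23 V 32 w\<close> and
  \<open>s\<^sub>j = u 32 V 23 w\<close>, each of the six words \<open>u xyz V zyx w\<close> becomes \<open>s\<^sub>i\<close> or \<open>s\<^sub>j\<close> once its two
  letters \<open>1\<close> are deleted, so all six have the same colour.
\<close>

section \<open>Ramsey's theorem with colours from any finite set\<close>

text \<open>Needed because the colours used later are vectors. A bijection \<open>e\<close> numbers
  them and \<open>Suc\<close> shifts the vertex set, which reduces the claim to
  \<open>ramsey_full\<close>.\<close>

lemma ramsey_finite_colours:
  assumes "finite C"
  shows "\<exists>N::nat. \<forall>f \<in> nsets {1..N} r \<rightarrow> C. \<exists>H \<in> nsets {1..N} m. \<exists>c. \<forall>S \<in> nsets H r. f S = c"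
proof -
  obtain e where e: "bij_betw e C {..<card C}"
    using bij_betw_iff_card[of C "{..<card C}"] assms by auto
  obtain N :: nat where N: "partn_lst {..<N} (replicate (card C) m) r"
    using ramsey_full by blast
  have "\<exists>H \<in> nsets {1..N} m. \<exists>c. \<forall>S \<in> nsets H r. f S = c" if f: "f \<in> nsets {1..N} r \<rightarrow> C" for f
  proof -
    have Suc_nsets: "Suc ` S \<in> nsets {1..N} q \<longleftrightarrow> S \<in> nsets {..<N} q" for S q
      by (auto simp: nsets_def card_image finite_image_iff image_subset_iff subset_iff Suc_le_eq)
    have "(\<lambda>S. e (f (Suc ` S))) \<in> nsets {..<N} r \<rightarrow> {..<card C}"
      using f e Suc_nsets by (fastforce simp: bij_betw_def Pi_iff)
    then obtain t H where t: "t < card C" and H: "H \<in> nsets {..<N} m"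
      and mono: "(\<lambda>S. e (f (Suc ` S))) ` nsets H r \<subseteq> {t}"
      using partn_lstE[OF N, of _ "card C"] by (metis length_replicate nth_replicate)
    have "\<forall>S \<in> nsets (Suc ` H) r. f S = the_inv_into C e t"
    proof
      fix S assume S: "S \<in> nsets (Suc ` H) r"
      then obtain S' where S': "S = Suc ` S'" "S' \<subseteq> H"
        by (auto simp: nsets_def subset_image_iff)
      have "S' \<in> nsets H r"
        using S S' by (auto simp: nsets_def card_image finite_image_iff)
      then have "e (f S) = t"
        using mono S'(1) by auto
      moreover have "f S \<in> C"
        using f \<open>S' \<in> nsets H r\<close> H S' Suc_nsets[of S' r] by (auto simp: nsets_def Pi_iff)
      ultimately show "f S = the_inv_into C e t"
        using e by (metis bij_betw_def the_inv_into_f_f)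
    qed
    then show ?thesis
      using H Suc_nsets by blast
  qed
  then show ?thesis by blast
qed

section \<open>Words written on sets of positions\<close>

text \<open>The cardinality is the rank of \<open>p\<close> in \<open>S\<close>, counted from
  0.\<close>

definition word_on :: "nat \<Rightarrow> nat set \<Rightarrow> (nat \<Rightarrow> nat) \<Rightarrow> nat \<Rightarrow> nat" where
  "word_on n S g = (\<lambda>p\<in>{1..n}. if p \<in> S then g (card {q \<in> S. q < p}) else 1)"

text \<open>The word \<open>s_i\<close>, continued to all places: slot \<open>i\<close> covers
  places \<open>2 * i\<close> and \<open>2 * i + 1\<close>.\<close>

definition slot_word :: "nat \<Rightarrow> nat \<Rightarrow> nat" where
  "slot_word i t = (if t div 2 = i then 2 + t mod 2 else 3 - t mod 2)"

lemma slot_word_bounds: "slot_word i t \<in> {1..3}"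
  by (auto simp: slot_word_def)

lemma slot_word_simps:
  "slot_word i (2 * i) = 2" "slot_word i (Suc (2 * i)) = 3"
  "i \<noteq> j \<Longrightarrow> slot_word i (2 * j) = 3" "i \<noteq> j \<Longrightarrow> slot_word i (Suc (2 * j)) = 2"
  by (auto simp: slot_word_def)

lemma slot_word_cong:
  "t \<notin> {2 * i, 2 * i + 1, 2 * j, 2 * j + 1} \<Longrightarrow> slot_word i t = slot_word j t"
  by (auto simp: slot_word_def)

lemma word_on_in_words3: "(\<And>t. g t \<in> {1..3}) \<Longrightarrow> word_on n S g \<in> words3 n"
  by (auto simp: word_on_def words3_def)

lemma word_on_strict_mono_image:
  fixes h :: "nat \<Rightarrow> nat"
  assumes "strict_mono_on {..<M} h" "T \<subseteq> {..<M}" "s \<in> T" "h s \<in> {1..n}"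
  shows "word_on n (h ` T) g (h s) = g (card (T \<inter> {..<s}))"
proof -
  have less: "h t < h s \<longleftrightarrow> t < s" if "t \<in> T" for t
    using assms that by (intro strict_mono_on_less[of "{..<M}"]) auto
  have "{q \<in> h ` T. q < h s} = h ` (T \<inter> {..<s})"
    using less by auto
  moreover have "inj_on h (T \<inter> {..<s})"
    using assms(2) by (intro inj_on_subset[OF strict_mono_on_imp_inj_on[OF assms(1)]]) auto
  ultimately show ?thesis
    using assms by (simp add: word_on_def card_image)
qed

text \<open>Each deleted place before \<open>s\<close> lowers its rank by one.\<close>

lemma card_remove_pair_below:
  fixes a b s M :: nat
  assumes "a < b" "s < M"
  shows "card (({..<M} - {a, b}) \<inter> {..<s}) = (if s \<le> a then s else if s \<le> b then s - 1 else s - 2)"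
proof -
  have eq: "({..<M} - {a, b}) \<inter> {..<s} = {..<s} - D" "D \<subseteq> {..<s}"
    if "D = {a, b} \<inter> {..<s}" for D
    using assms that by auto
  have D: "(if s \<le> a then {} else if s \<le> b then {a} else {a, b}) = {a, b} \<inter> {..<s}"
    using assms by auto
  have "card (({..<M} - {a, b}) \<inter> {..<s}) = s - card (if s \<le> a then {} else if s \<le> b then {a} else {a, b})"
    unfolding eq(1)[OF D] using eq(2)[OF D] by (subst card_Diff_subset) (auto simp: finite_subset)
  then show ?thesis
    using assms by (simp add: numeral_2_eq_2)
qed

text \<open>The letters of \<open>u\<close>, \<open>V\<close> and \<open>w\<close>, indexed by their places in \<open>u xyz V zyx w\<close>. The index
  drops by one after each of \<open>xyz\<close> and \<open>zyx\<close>, since both contain exactly one \<open>1\<close>.\<close>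

definition common_word :: "nat \<Rightarrow> nat \<Rightarrow> nat \<Rightarrow> nat" where
  "common_word i j s = slot_word i (if s < 2 * i then s else if s \<le> 2 * j then s - 1 else s - 2)"

section \<open>Collapsing the six template words\<close>

lemma permutes_3_cases:
  assumes "v permutes {1..3::nat}"
  shows "(v 1, v 2, v 3) \<in> {(1,2,3), (1,3,2), (2,1,3), (2,3,1), (3,1,2), (3,2,1)}"
proof -
  have "{1..3::nat} = {1, 2, 3}"
    by auto
  then have "v 1 \<in> {1, 2, 3}" "v 2 \<in> {1, 2, 3}" "v 3 \<in> {1, 2, 3}"
    using permutes_in_image[OF assms] by blast+
  moreover have "v 1 \<noteq> v 2" "v 1 \<noteq> v 3" "v 2 \<noteq> v 3"
    using permutes_inj[OF assms] by (auto simp: inj_eq)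
  ultimately show ?thesis
    by (elim insertE emptyE) simp_all
qed

text \<open>Here \<open>xyz\<close> starts at place \<open>2 * i\<close> and \<open>zyx\<close> at
  \<open>2 * j + 1\<close>. The set \<open>S\<close> omits the two block positions with letter
  \<open>1\<close>; they merge into the default letter of \<open>word_on\<close>.\<close>

lemma template_word_collapse:
  fixes h :: "nat \<Rightarrow> nat"
  assumes h: "strict_mono_on {..<L + 2} h" "h ` {..<L + 2} \<subseteq> {1..n}"
    and ij: "i < j" "2 * j + 2 \<le> L"
    and w: "w \<in> words3 n"
    and v: "v permutes {1..3}"
    and x: "w (h (2 * i)) = v 1" "w (h (2 * j + 3)) = v 1"
    and y: "w (h (2 * i + 1)) = v 2" "w (h (2 * j + 2)) = v 2"
    and z: "w (h (2 * i + 2)) = v 3" "w (h (2 * j + 1)) = v 3"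
    and fixed: "\<And>s. s < L + 2 \<Longrightarrow> s < 2 * i \<or> 2 * i + 2 < s \<and> s \<le> 2 * j \<or> 2 * j + 3 < s
                  \<Longrightarrow> w (h s) = common_word i j s"
    and outside: "\<And>p. p \<in> {1..n} - h ` {..<L + 2} \<Longrightarrow> w p = 1"
  shows "\<exists>S \<in> nsets (h ` {..<L + 2}) L. w = word_on n S (slot_word i) \<or> w = word_on n S (slot_word j)"
proof -
  have inj: "inj_on h {..<L + 2}"
    using h(1) strict_mono_on_imp_inj_on by blast
  \<comment> \<open>\<open>e\<close> is the offset of the letter \<open>1\<close> in
    \<open>xyz\<close>; by reflection it is at \<open>2 * j + 3 - e\<close> in \<open>zyx\<close>.
    Only the six block places are left to check in each case.\<close>
  have collapse: "\<exists>S \<in> nsets (h ` {..<L + 2}) L. w = word_on n S (slot_word i) \<or> w = word_on n S (slot_word j)"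
    if e: "e \<le> 2" and one: "w (h (2 * i + e)) = 1" "w (h (2 * j + 3 - e)) = 1"
      and l: "l \<in> {i, j}"
      and agree: "\<And>s. s \<in> {2 * i, 2 * i + 1, 2 * i + 2, 2 * j + 1, 2 * j + 2, 2 * j + 3} \<Longrightarrow>
          s \<notin> {2 * i + e, 2 * j + 3 - e} \<Longrightarrow>
          w (h s) = slot_word l (if s \<le> 2 * i + e then s else if s \<le> 2 * j + 3 - e then s - 1 else s - 2)"
    for e l
  proof -
    define T where "T = {..<L + 2} - {2 * i + e, 2 * j + 3 - e}"
    have T: "T \<subseteq> {..<L + 2}" "card T = L"
      using ij e by (auto simp: T_def card_Diff_subset)
    have "w p = word_on n (h ` T) (slot_word l) p" for p
    proof (cases "p \<in> h ` {..<L + 2}")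
      case False
      then show ?thesis
        using outside[of p] w T(1) by (auto simp: word_on_def words3_def PiE_def extensional_def)
    next
      case True
      then obtain s where s: "s < L + 2" "p = h s" by auto
      have p: "h s \<in> {1..n}" using h(2) s by auto
      show ?thesis
      proof (cases "s \<in> T")
        case False
        then have "h s \<notin> h ` T"
          using inj T(1) s(1) by (auto simp: inj_on_def)
        then show ?thesis
          using False s one p by (auto simp: T_def word_on_def)
      next
        case True
        have "word_on n (h ` T) (slot_word l) p =
            slot_word l (if s \<le> 2 * i + e then s else if s \<le> 2 * j + 3 - e then s - 1 else s - 2)"
          unfolding s(2) word_on_strict_mono_image[OF h(1) T(1) True p]
          unfolding T_def using ij e s(1) by (subst card_remove_pair_below) auto
        also have "\<dots> = w (h s)"
        proof (cases "s \<in> {2 * i, 2 * i + 1, 2 * i + 2, 2 * j + 1, 2 * j + 2, 2 * j + 3}")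
          case in_block: True
          with agree[of s] True show ?thesis by (auto simp: T_def)
        next
          case False
          then have range: "s < 2 * i \<or> 2 * i + 2 < s \<and> s \<le> 2 * j \<or> 2 * j + 3 < s"
            by simp presburger
          then have "w (h s) = common_word i j s"
            using fixed[OF s(1)] by blast
          moreover have "(if s \<le> 2 * i + e then s else if s \<le> 2 * j + 3 - e then s - 1 else s - 2) =
              (if s < 2 * i then s else if s \<le> 2 * j then s - 1 else s - 2)" (is "_ = ?t")
            using range ij e by auto
          \<comment> \<open>Outside the blocks the shifted index avoids slots \<open>i\<close> and
            \<open>j\<close>, where alone \<open>s_i\<close> and \<open>s_j\<close> differ.\<close>
          moreover have "?t \<notin> {2 * i, 2 * i + 1, 2 * j, 2 * j + 1}"
            using range ij by (elim disjE) auto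
          then have "slot_word l ?t = slot_word i ?t"
            using l slot_word_cong[of ?t i j] by (metis insertE singletonD)
          ultimately show ?thesis
            by (simp only: common_word_def)
        qed
        finally show ?thesis using s by simp
      qed
    qed
    then have "w = word_on n (h ` T) (slot_word l)" by (rule ext)
    moreover have "h ` T \<in> nsets (h ` {..<L + 2}) L"
      using T inj by (auto simp: nsets_def card_image inj_on_subset finite_subset)
    ultimately show ?thesis using l by blast
  qed
  \<comment> \<open>The result is \<open>s_i\<close> if \<open>2\<close> precedes \<open>3\<close>
    in \<open>xyz\<close>, and \<open>s_j\<close> otherwise.\<close>
  from permutes_3_cases[OF v] consider
      "v 1 = 1" "v 2 = 2" "v 3 = 3" | "v 1 = 1" "v 2 = 3" "v 3 = 2"
    | "v 1 = 2" "v 2 = 1" "v 3 = 3" | "v 1 = 2" "v 2 = 3" "v 3 = 1"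
    | "v 1 = 3" "v 2 = 1" "v 3 = 2" | "v 1 = 3" "v 2 = 2" "v 3 = 1"
    by auto
  then show ?thesis
  proof cases
    case 1
    show ?thesis
      by (rule collapse[of 0 i]) (use 1 x y z ij in \<open>auto simp: slot_word_simps\<close>)
  next
    case 2
    show ?thesis
      by (rule collapse[of 0 j]) (use 2 x y z ij in \<open>auto simp: slot_word_simps\<close>)
  next
    case 3
    show ?thesis
      by (rule collapse[of 1 i]) (use 3 x y z ij in \<open>auto simp: slot_word_simps\<close>)
  next
    case 4
    show ?thesis
      by (rule collapse[of 2 i]) (use 4 x y z ij in \<open>auto simp: slot_word_simps\<close>)
  next
    case 5
    show ?thesis
      by (rule collapse[of 1 j]) (use 5 x y z ij in \<open>auto simp: slot_word_simps\<close>)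
  next
    case 6
    show ?thesis
      by (rule collapse[of 2 j]) (use 6 x y z ij in \<open>auto simp: slot_word_simps\<close>)
  qed
qed

theorem theorem3:
  fixes k :: nat
  assumes "k > 0"
  shows "\<exists>n>0. \<forall>\<chi> \<in> words3 n \<rightarrow> {1..k}.
           \<exists>I a. blocks n I \<and> a \<in> fixed_positions n I \<rightarrow> {1..3} \<and>
             pattern_ABCCBA n I \<and> monochromatic \<chi> (block_set_123 n I a)"
proof -
  \<comment> \<open>Room for \<open>k + 1\<close> slots, one more than the number of
    colours.\<close>
  define L where "L = 2 * (k + 1)"
  have "finite ({..k} \<rightarrow>\<^sub>E {1..k})"
    by (simp add: finite_PiE)
  from ramsey_finite_colours[OF this, of L "L + 2"]
  obtain n :: nat where n: "\<forall>f \<in> nsets {1..n} L \<rightarrow> ({..k} \<rightarrow>\<^sub>E {1..k}).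
      \<exists>H \<in> nsets {1..n} (L + 2). \<exists>c. \<forall>S \<in> nsets H L. f S = c"
    by (rule exE)
  have main: "\<exists>I a. blocks n I \<and> a \<in> fixed_positions n I \<rightarrow> {1..3} \<and>
      pattern_ABCCBA n I \<and> monochromatic \<chi> (block_set_123 n I a) \<and> n > 0"
    if \<chi>: "\<chi> \<in> words3 n \<rightarrow> {1..k}" for \<chi>
  proof -
    define f where "f S = (\<lambda>i\<in>{..k}. \<chi> (word_on n S (slot_word i)))" for S
    have \<chi>_slot: "\<chi> (word_on n S (slot_word i)) \<in> {1..k}" for S i
      using \<chi> word_on_in_words3 slot_word_bounds by blast
    then have "f \<in> nsets {1..n} L \<rightarrow> ({..k} \<rightarrow>\<^sub>E {1..k})"
      by (auto simp: f_def)
    from bspec[OF n this] obtain H c where H: "H \<in> nsets {1..n} (L + 2)" and c: "\<And>S. S \<in> nsets H L \<Longrightarrow> f S = c"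
      by blast
    have card_H: "card H = L + 2" "finite H" "H \<subseteq> {1..n}"
      using H by (auto simp: nsets_def)
    have colour: "\<chi> (word_on n S (slot_word i)) = c i" if "S \<in> nsets H L" "i \<le> k" for S i
      using c[OF that(1)] that(2) by (auto simp: f_def)
    \<comment> \<open>An actual \<open>L\<close>-subset is what forces the entries of
      \<open>c\<close> into \<open>{1..k}\<close>.\<close>
    obtain S0 where S0: "S0 \<in> nsets H L"
      using card_H nsets_eq_empty_iff[of H L] by auto
    have "c ` {..k} \<subseteq> {1..k}"
      using colour[OF S0] \<chi>_slot by (metis atMost_iff image_subsetI)
    then have "\<not> inj_on c {..k}"
      using card_inj_on_le[of c "{..k}" "{1..k}"] by auto
    then obtain i j where ij: "i < j" "j \<le> k" "c i = c j"
      by (auto simp: inj_on_def) (metis linorder_neqE_nat)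
    have jL: "2 * j + 2 \<le> L" using ij by (simp add: L_def)
    obtain h where bij: "bij_betw h {..<L + 2} H" and h: "strict_mono_on {..<L + 2} h"
      using ex_bij_betw_strict_mono_card[OF card_H(2)] card_H(1) by metis
    have im: "h ` {..<L + 2} = H" using bij by (simp add: bij_betw_def)
    have inj: "inj_on h {..<L + 2}" using bij by (simp add: bij_betw_def)
    have hs: "h s < h t \<longleftrightarrow> s < t" if "s < L + 2" "t < L + 2" for s t
      using strict_mono_on_less[OF h] that by simp
    have heq: "h s = h t \<longleftrightarrow> s = t" if "s < L + 2" "t < L + 2" for s t
      using inj that by (auto simp: inj_on_def)
    have h_range: "h s \<in> {1..n}" if "s < L + 2" for s
      using im that card_H(3) by blast
    then have h_bounds: "Suc 0 \<le> h s" "h s \<le> n" if "s < L + 2" for s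
      using that by auto
    \<comment> \<open>Blocks \<open>1\<close>, \<open>2\<close>, \<open>3\<close> carry the letters
      \<open>x\<close>, \<open>y\<close>, \<open>z\<close>, hence are \<open>A\<close>,
      \<open>B\<close>, \<open>C\<close> of the pattern.\<close>
    define I where "I l = (if l = 1 then {h (2 * i), h (2 * j + 3)}
      else if l = 2 then {h (2 * i + 1), h (2 * j + 2)}
      else {h (2 * i + 2), h (2 * j + 1)})" for l :: nat
    \<comment> \<open>The fixed letters are those of \<open>u\<close>, \<open>V\<close>,
      \<open>w\<close> on \<open>H\<close>, and \<open>1\<close> off \<open>H\<close>.\<close>
    define a where "a = word_on n H (common_word i j)"
    have three: "{1..3::nat} = {1, 2, 3}" by auto
    have I: "I (Suc 0) = {h (2 * i), h (2 * j + 3)}" "I 1 = {h (2 * i), h (2 * j + 3)}" "I 2 = {h (2 * i + 1), h (2 * j + 2)}"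
      "I 3 = {h (2 * i + 2), h (2 * j + 1)}"
      by (auto simp: I_def)
    have "blocks n I"
      unfolding blocks_def three disjoint_family_on_def
      using ij(1) jL by (simp add: I heq h_bounds)
    moreover have "a \<in> fixed_positions n I \<rightarrow> {1..3}"
      using slot_word_bounds by (auto simp: a_def word_on_def common_word_def fixed_positions_def)
    moreover have "pattern_ABCCBA n I"
      unfolding pattern_ABCCBA_def
    proof (intro exI conjI)
      show "{h (2 * i), h (2 * i + 1), h (2 * i + 2), h (2 * j + 1), h (2 * j + 2), h (2 * j + 3)} \<subseteq> {1..n}"
        using ij(1) jL by (simp add: h_bounds)
      show "I ` {1..3} = {{h (2 * i), h (2 * j + 3)}, {h (2 * i + 1), h (2 * j + 2)},
          {h (2 * i + 2), h (2 * j + 1)}}"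
        unfolding three by (simp add: I)
    qed (use ij(1) jL in \<open>simp_all add: hs\<close>)
    moreover have "\<chi> w = c i" if w_block: "w \<in> block_set_123 n I a" for w
    proof -
      obtain v where w: "w \<in> words3 n" and fixed: "\<And>p. p \<in> fixed_positions n I \<Longrightarrow> w p = a p"
        and v: "v permutes {1..3}" and block: "\<And>l p. l \<in> {1..3} \<Longrightarrow> p \<in> I l \<Longrightarrow> w p = v l"
        using w_block unfolding block_set_123_def by blast
      have "\<exists>S \<in> nsets (h ` {..<L + 2}) L. w = word_on n S (slot_word i) \<or> w = word_on n S (slot_word j)"
      proof (rule template_word_collapse[OF h _ ij(1) jL w v])
        fix s assume s: "s < L + 2" "s < 2 * i \<or> 2 * i + 2 < s \<and> s \<le> 2 * j \<or> 2 * j + 3 < s"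
        have "h s \<in> fixed_positions n I"
          unfolding fixed_positions_def three using s ij(1) jL by (auto simp: I heq h_bounds)
        then have "w (h s) = word_on n (h ` {..<L + 2}) (common_word i j) (h s)"
          unfolding im using fixed by (simp add: a_def)
        also have "\<dots> = common_word i j (card ({..<L + 2} \<inter> {..<s}))"
          using s h_range by (intro word_on_strict_mono_image[OF h]) auto
        also have "{..<L + 2} \<inter> {..<s} = {..<s}" using s by auto
        finally show "w (h s) = common_word i j s" by simp
      next
        fix p assume p: "p \<in> {1..n} - h ` {..<L + 2}"
        then have "p \<in> fixed_positions n I"
          unfolding fixed_positions_def three using ij(1) jL by (auto simp: I)
        then show "w p = 1"
          using fixed p unfolding im by (simp add: a_def word_on_def)
      qed (use im card_H block[of 1] block[of 2] block[of 3] in \<open>simp_all add: I\<close>)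
      then show ?thesis
        using colour ij im by auto
    qed
    then have "monochromatic \<chi> (block_set_123 n I a)"
      unfolding Defs.monochromatic_def by blast
    moreover have "n > 0" using card_H by (cases n) auto
    ultimately show ?thesis by (intro exI[of _ I] exI[of _ a]) simp
  qed
  \<comment> \<open>Since \<open>n\<close> must be positive before a colouring is given,
    \<open>main\<close> is applied to a constant colouring, which exists as
    \<open>k > 0\<close>.\<close>
  have "(\<lambda>_. 1) \<in> words3 n \<rightarrow> {1..k}" using assms by auto
  from main[OF this] have "n > 0" by (elim exE conjE)
  then show ?thesis
  proof (intro exI[of _ n] conjI ballI)
    fix \<chi> assume "\<chi> \<in> words3 n \<rightarrow> {1..k}"
    from main[OF this] show "\<exists>I a. blocks n I \<and> a \<in> fixed_positions n I \<rightarrow> {1..3} \<and>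
        pattern_ABCCBA n I \<and> monochromatic \<chi> (block_set_123 n I a)"
      by (elim exE conjE) (intro exI conjI)
  qed
qed

end
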